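(* Let $p\in[1,\infty]$, $K\ge1$, $K'\ge0$. Let $F:\mathbb{T}\to\mathbb{C}$ be absolutely continuous with $\dot F\in L^{p}(\mathbb{T})$, and suppose $f=P[F]$ is a $(K,K')$-elliptic mapping in $\mathbb{D}$. Then both $f_z$ and $\overline{f_{\overline z}}$ belong to the Hardy space $\mathcal{H}^{p}(\mathbb{D})$.
   Context: $\mathbb{D}$ is the open unit disk, $\mathbb{T}=\partial\mathbb{D}$. For $z=x+iy$, $\partial/\partial z=\frac12(\partial_x-i\partial_y)$ and $\partial/\partial\overline z=\frac12(\partial_x+i\partial_y)$. For $F\in L^1(\mathbb{T})$ the Poisson integral is $P[F](z)=\int_0^{2\pi}P(z,e^{i\theta})F(e^{i\theta})\,d\theta$ with $P(z,e^{i\theta})=\frac{1}{2\pi}\frac{1-|z|^2}{|1-ze^{-i\theta}|^2}$. $\dot F(e^{i\theta})=\frac{d}{d\theta}F(e^{i\theta})$ (defined a.e.); $L^p(\mathbb{T})$ has norm $\|F\|_{L^p}=\big(\frac{1}{2\pi}\int_0^{2\pi}|F(e^{i\theta})|^pd\theta\big)^{1/p}$ (ess sup if $p=\infty$). For a $C^1$ map $f$, $\|D_f(z)\|=|f_z(z)|+|f_{\overline z}(z)|$ and the Jacobian is $J_f=|f_z|^2-|f_{\overline z}|^2$; $f$ is sense-preserving if $J_f>0$. A sense-preserving continuously differentiable mapping $f:\mathbb{D}\to\mathbb{C}$ that is absolutely continuous on lines in $\mathbb{D}$ is a $(K,K')$-elliptic mapping if $\|D_f(z)\|^2\le KJ_f(z)+K'$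 for all $z\in\mathbb{D}$. For $p\in(0,\infty)$, $\mathcal{H}^p(\mathbb{D})$ is the space of analytic $g$ on $\mathbb{D}$ with $\sup_{0<r<1}\big(\frac1{2\pi}\int_0^{2\pi}|g(re^{i\theta})|^pd\theta\big)^{1/p}<\infty$; $\mathcal{H}^\infty(\mathbb{D})$ is the space of bounded analytic functions on $\mathbb{D}$. *)

theory Defs
  imports "HOL-Analysis.Analysis"
begin

definition abs_cont_on_interval :: "(real \<Rightarrow> complex) \<Rightarrow> real \<Rightarrow> real \<Rightarrow> bool" where
  "abs_cont_on_interval g a b \<longleftrightarrow>
     (\<forall>\<epsilon>>0. \<exists>\<delta>>0. \<forall>(n::nat) (u::nat \<Rightarrow> real) (v::nat \<Rightarrow> real).
        (\<forall>k<n. a \<le> u k \<and> u k \<le> v k \<and> v k \<le> b) \<and>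
        (\<forall>k<n. \<forall>j<n. k < j \<longrightarrow> v k \<le> u j) \<and>
        (\<Sum>k<n. v k - u k) < \<delta>
        \<longrightarrow> (\<Sum>k<n. norm (g (v k) - g (u k))) < \<epsilon>)"

definition abs_cont_circle :: "(complex \<Rightarrow> complex) \<Rightarrow> bool" where
  "abs_cont_circle F \<longleftrightarrow> abs_cont_on_interval (\<lambda>t. F (cis t)) 0 (2*pi)"

definition in_Lp_circle :: "ennreal \<Rightarrow> (real \<Rightarrow> complex) \<Rightarrow> bool" where
  "in_Lp_circle p g \<longleftrightarrow> g measurable_on {0..2*pi} \<and>
     (if p = \<infinity> then (\<exists>M. AE t in lebesgue. t \<in> {0..2*pi} \<longrightarrow> norm (g t) \<le> M)
      else (\<lambda>t. norm (g t) powr (enn2real p)) integrable_on {0..2*pi})"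

definition deriv_in_Lp_circle :: "ennreal \<Rightarrow> (complex \<Rightarrow> complex) \<Rightarrow> bool" where
  "deriv_in_Lp_circle p F \<longleftrightarrow> (\<exists>g. in_Lp_circle p g \<and>
     (AE t in lebesgue. t \<in> {0..2*pi} \<longrightarrow> ((\<lambda>s. F (cis s)) has_vector_derivative g t) (at t)))"

definition poisson_kernel :: "complex \<Rightarrow> real \<Rightarrow> real" where
  "poisson_kernel z t = (1 - (cmod z)\<^sup>2) / (2*pi * (cmod (1 - z * cis (-t)))\<^sup>2)"

definition poisson_integral :: "(complex \<Rightarrow> complex) \<Rightarrow> complex \<Rightarrow> complex" where
  "poisson_integral F z = integral {0..2*pi} (\<lambda>t. of_real (poisson_kernel z t) * F (cis t))"

definition dz :: "(complex \<Rightarrow> complex) \<Rightarrow> complex \<Rightarrow> complex" where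
  "dz f z = (frechet_derivative f (at z) 1 - \<i> * frechet_derivative f (at z) \<i>) / 2"

definition dzbar :: "(complex \<Rightarrow> complex) \<Rightarrow> complex \<Rightarrow> complex" where
  "dzbar f z = (frechet_derivative f (at z) 1 + \<i> * frechet_derivative f (at z) \<i>) / 2"

definition jacobian :: "(complex \<Rightarrow> complex) \<Rightarrow> complex \<Rightarrow> real" where
  "jacobian f z = (cmod (dz f z))\<^sup>2 - (cmod (dzbar f z))\<^sup>2"

definition Dnorm :: "(complex \<Rightarrow> complex) \<Rightarrow> complex \<Rightarrow> real" where
  "Dnorm f z = cmod (dz f z) + cmod (dzbar f z)"

definition ACL_on :: "complex set \<Rightarrow> (complex \<Rightarrow> complex) \<Rightarrow> bool" where
  "ACL_on U f \<longleftrightarrow> (\<forall>a b c d. a \<le> b \<and> c \<le> d \<and>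
       {z. a \<le> Re z \<and> Re z \<le> b \<and> c \<le> Im z \<and> Im z \<le> d} \<subseteq> U \<longrightarrow>
       (AE y in lebesgue. y \<in> {c..d} \<longrightarrow> abs_cont_on_interval (\<lambda>x. f (Complex x y)) a b) \<and>
       (AE x in lebesgue. x \<in> {a..b} \<longrightarrow> abs_cont_on_interval (\<lambda>y. f (Complex x y)) c d))"

definition elliptic_mapping :: "real \<Rightarrow> real \<Rightarrow> (complex \<Rightarrow> complex) \<Rightarrow> bool" where
  "elliptic_mapping K K' f \<longleftrightarrow>
     f differentiable_on ball 0 1 \<and>
     continuous_on (ball 0 1) (dz f) \<and> continuous_on (ball 0 1) (dzbar f) \<and>
     ACL_on (ball 0 1) f \<and>
     (\<forall>z\<in>ball 0 1. jacobian f z > 0) \<and>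
     (\<forall>z\<in>ball 0 1. (Dnorm f z)\<^sup>2 \<le> K * jacobian f z + K')"

definition hardy :: "ennreal \<Rightarrow> (complex \<Rightarrow> complex) \<Rightarrow> bool" where
  "hardy p g \<longleftrightarrow> g holomorphic_on ball 0 1 \<and>
     (if p = \<infinity> then bounded (g ` ball 0 1)
      else (\<exists>M. \<forall>r. 0 < r \<and> r < 1 \<longrightarrow>
         (1/(2*pi) * integral {0..2*pi} (\<lambda>t. cmod (g (of_real r * cis t)) powr (enn2real p)))
           powr (1 / enn2real p) \<le> M))"

end

theory Submission
  imports Defs
begin

text \<open>Integration by parts shows that the angular derivative
  \<open>i (z f\<^sub>z - cnj z f\<^bsub>cnj z\<^esub>)\<close> of \<open>f = P[F]\<close> is the Poisson integral of the derivative \<open>g\<close> of \<open>F\<close>,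
  so \<open>|z| (|f\<^sub>z| - |f\<^bsub>cnj z\<^esub>|) \<le> P[|g|]\<close>. Ellipticity reads
  \<open>\<Lambda>\<^sup>2 \<le> K \<Lambda> \<lambda> + K'\<close> with \<open>\<Lambda> = |f\<^sub>z| + |f\<^bsub>cnj z\<^esub>|\<close> and \<open>\<lambda> = |f\<^sub>z| - |f\<^bsub>cnj z\<^esub>|\<close>, whence
  \<open>\<Lambda> \<le> K \<lambda> + sqrt K'\<close>. As \<open>\<Lambda>\<close> is bounded for \<open>|z| \<le> 1/2\<close>, it follows that
  \<open>\<Lambda> \<le> P[2 K |g| + C]\<close> on the whole disk, and a function dominated by the Poisson integral of an
  \<open>L\<^sup>p\<close> function has bounded \<open>L\<^sup>p\<close> means by Jensen's inequality and Tonelli's theorem.\<close>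

section \<open>Absolute continuity and the fundamental theorem of calculus\<close>

text \<open>Tagged divisions give unordered families of intervals, so the condition is recast with a
  finite set \<open>A\<close> of left endpoints and a function \<open>V\<close> for the right ends;
  sorting \<open>A\<close> recovers the ordered sequences of the definition.\<close>

lemma abs_cont_on_interval_finite_set:
  assumes "abs_cont_on_interval g a b" "0 < \<epsilon>"
  obtains \<delta> where "0 < \<delta>"
    "\<And>A V. \<lbrakk>finite A; \<And>u. u \<in> A \<Longrightarrow> a \<le> u \<and> u \<le> V u \<and> V u \<le> b;
        \<And>u u'. \<lbrakk>u \<in> A; u' \<in> A; u < u'\<rbrakk> \<Longrightarrow> V u \<le> u'; (\<Sum>u\<in>A. V u - u) < \<delta>\<rbrakk>
        \<Longrightarrow> (\<Sum>u\<in>A. norm (g (V u) - g u)) < \<epsilon>"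
proof -
  obtain \<delta> where "\<delta> > 0" and \<delta>: "\<And>n u v.
        (\<forall>k<n. a \<le> u k \<and> u k \<le> v k \<and> v k \<le> b) \<and>
        (\<forall>k<n. \<forall>j<n. k < j \<longrightarrow> v k \<le> u j) \<and>
        (\<Sum>k<(n::nat). v k - u k) < \<delta>
        \<longrightarrow> (\<Sum>k<n. norm (g (v k) - g (u k))) < \<epsilon>"
    using assms unfolding abs_cont_on_interval_def by blast
  have "(\<Sum>u\<in>A. norm (g (V u) - g u)) < \<epsilon>"
    if A: "finite A" and bnd: "\<And>u. u \<in> A \<Longrightarrow> a \<le> u \<and> u \<le> V u \<and> V u \<le> b"
      and sep: "\<And>u u'. \<lbrakk>u \<in> A; u' \<in> A; u < u'\<rbrakk> \<Longrightarrow> V u \<le> u'"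
      and small: "(\<Sum>u\<in>A. V u - u) < \<delta>" for A V
  proof -
    define xs where "xs = sorted_list_of_set A"
    have bij: "bij_betw ((!) xs) {..<length xs} A"
      using A by (intro bij_betw_nth) (auto simp: xs_def)
    have in_A: "xs ! k \<in> A" if "k < length xs" for k
      using bij that by (auto simp: bij_betw_def)
    have less: "xs ! k < xs ! j" if "k < j" "j < length xs" for k j
      using A that strict_sorted_list_of_set[of A] by (auto simp: xs_def sorted_wrt_iff_nth_less)
    have eq: "(\<Sum>k<length xs. h (xs ! k)) = sum h A" for h :: "real \<Rightarrow> real"
      by (rule sum.reindex_bij_betw[OF bij])
    show ?thesis
      using \<delta>[of "length xs" "\<lambda>k. xs ! k" "\<lambda>k. V (xs ! k)"] bnd sep small in_A less
      by (simp add: eq[of "\<lambda>u. V u - u"] eq[of "\<lambda>u. norm (g (V u) - g u)"])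
  qed
  with \<open>\<delta> > 0\<close> that show ?thesis by blast
qed

text \<open>The one-interval case of absolute continuity, applied to the interval between
  \<open>x\<close> and \<open>y\<close>.\<close>

lemma abs_cont_on_interval_imp_continuous_on:
  assumes "abs_cont_on_interval g a b"
  shows "continuous_on {a..b} g"
  unfolding continuous_on_iff
proof (intro ballI allI impI)
  fix x \<epsilon> :: real assume x: "x \<in> {a..b}" and "0 < \<epsilon>"
  obtain \<delta> where "0 < \<delta>" and \<delta>: "\<And>A V. \<lbrakk>finite A; \<And>u. u \<in> A \<Longrightarrow> a \<le> u \<and> u \<le> V u \<and> V u \<le> b;
        \<And>u u'. \<lbrakk>u \<in> A; u' \<in> A; u < u'\<rbrakk> \<Longrightarrow> V u \<le> u'; (\<Sum>u\<in>A. V u - u) < \<delta>\<rbrakk>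
        \<Longrightarrow> (\<Sum>u\<in>A. norm (g (V u) - g u)) < \<epsilon>"
    using abs_cont_on_interval_finite_set[OF assms \<open>0 < \<epsilon>\<close>] by blast
  have "dist (g y) (g x) < \<epsilon>" if "y \<in> {a..b}" "dist y x < \<delta>" for y
    using \<delta>[of "{min x y}" "\<lambda>_. max x y"] x that
    by (cases "x \<le> y") (auto simp: dist_norm norm_minus_commute)
  then show "\<exists>d>0. \<forall>y\<in>{a..b}. dist y x < d \<longrightarrow> dist (g y) (g x) < \<epsilon>"
    using \<open>0 < \<delta>\<close> by blast
qed

text \<open>\<open>\<phi>\<close> is Lipschitz because \<open>\<phi>'\<close> is bounded on the
  compact interval, and both factors are bounded, so increments of the product are controlled by
  those of \<open>g\<close> and by interval lengths. This prepares the integration by parts against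
  the Cauchy kernel.\<close>

lemma abs_cont_on_interval_mult_C1:
  assumes g: "abs_cont_on_interval g a b"
    and der: "\<And>t. t \<in> {a..b} \<Longrightarrow> (\<phi> has_vector_derivative \<phi>' t) (at t within {a..b})"
    and cont: "continuous_on {a..b} \<phi>'"
  shows "abs_cont_on_interval (\<lambda>t. \<phi> t * g t) a b"
proof -
  have cg: "continuous_on {a..b} g" by (rule abs_cont_on_interval_imp_continuous_on[OF g])
  have c\<phi>: "continuous_on {a..b} \<phi>"
    by (meson der continuous_on_eq_continuous_within has_vector_derivative_continuous)
  have bounded: "\<exists>B>0. \<forall>t\<in>{a..b}. norm (h t) \<le> B" if "continuous_on {a..b} h" for h :: "real \<Rightarrow> complex"
    using compact_imp_bounded[OF compact_continuous_image[OF that compact_Icc]]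
    by (auto simp: bounded_pos)
  obtain B L M where B: "B > 0" "\<And>t. t \<in> {a..b} \<Longrightarrow> norm (\<phi> t) \<le> B"
    and L: "L > 0" "\<And>t. t \<in> {a..b} \<Longrightarrow> norm (\<phi>' t) \<le> L"
    and M: "M > 0" "\<And>t. t \<in> {a..b} \<Longrightarrow> norm (g t) \<le> M"
    using bounded[OF c\<phi>] bounded[OF cont] bounded[OF cg] by metis
  have lip: "norm (\<phi> v - \<phi> u) \<le> L * (v - u)" if "a \<le> u" "u \<le> v" "v \<le> b" for u v
  proof -
    have "norm (\<phi> v - \<phi> u) \<le> L * norm (v - u)"
      by (rule differentiable_bound[of "{a..b}" \<phi> "\<lambda>t h. h *\<^sub>R \<phi>' t"])
        (use that der L in \<open>auto simp: has_vector_derivative_def mult.commute[of L] intro!: onorm_le mult_left_mono\<close>)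
    then show ?thesis using that by simp
  qed
  have pt: "norm (\<phi> v * g v - \<phi> u * g u) \<le> B * norm (g v - g u) + M * L * (v - u)"
    if "a \<le> u" "u \<le> v" "v \<le> b" for u v
  proof -
    have "norm (\<phi> v * g v - \<phi> u * g u) = norm (\<phi> v * (g v - g u) + (\<phi> v - \<phi> u) * g u)"
      by (simp add: algebra_simps)
    also have "\<dots> \<le> norm (\<phi> v) * norm (g v - g u) + norm (\<phi> v - \<phi> u) * norm (g u)"
      by (metis norm_mult norm_triangle_ineq)
    also have "\<dots> \<le> B * norm (g v - g u) + (L * (v - u)) * M"
      by (intro add_mono mult_mono B M lip) (use that L B in auto)
    finally show ?thesis by (simp add: algebra_simps)
  qed
  show ?thesis
    unfolding abs_cont_on_interval_def
  proof (intro allI impI)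
    fix \<epsilon> :: real assume "\<epsilon> > 0"
    then have "\<epsilon> / (2 * B) > 0" using B by simp
    then obtain \<delta> where "\<delta> > 0" and \<delta>: "\<forall>n u v.
        (\<forall>k<n. a \<le> u k \<and> u k \<le> v k \<and> v k \<le> b) \<and>
        (\<forall>k<n. \<forall>j<n. k < j \<longrightarrow> v k \<le> u j) \<and>
        (\<Sum>k<(n::nat). v k - u k) < \<delta>
        \<longrightarrow> (\<Sum>k<n. norm (g (v k) - g (u k))) < \<epsilon> / (2 * B)"
      using g unfolding abs_cont_on_interval_def by blast
    show "\<exists>\<delta>>0. \<forall>n u v.
        (\<forall>k<n. a \<le> u k \<and> u k \<le> v k \<and> v k \<le> b) \<and>
        (\<forall>k<n. \<forall>j<n. k < j \<longrightarrow> v k \<le> u j) \<and>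
        (\<Sum>k<(n::nat). v k - u k) < \<delta>
        \<longrightarrow> (\<Sum>k<n. norm (\<phi> (v k) * g (v k) - \<phi> (u k) * g (u k))) < \<epsilon>"
    \<comment> \<open>The first entry keeps \<open>B\<close> times the increments of
      \<open>g\<close> below \<epsilon>/2, the second keeps \<open>M * L\<close> times the total
      length below \<epsilon>/2.\<close>
    proof (intro exI[of _ "min \<delta> (\<epsilon> / (2 * M * L))"] conjI allI impI; (elim conjE)?)
      show "0 < min \<delta> (\<epsilon> / (2 * M * L))" using \<open>\<delta> > 0\<close> \<open>\<epsilon> > 0\<close> M L by simp
    next
      fix n u v
      assume uv: "\<forall>k<n. a \<le> u k \<and> u k \<le> v k \<and> v k \<le> b"
        "\<forall>k<n. \<forall>j<n. k < j \<longrightarrow> v k \<le> u j"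
        "(\<Sum>k<(n::nat). v k - u k) < min \<delta> (\<epsilon> / (2 * M * L))"
      have "(\<Sum>k<n. norm (\<phi> (v k) * g (v k) - \<phi> (u k) * g (u k)))
          \<le> (\<Sum>k<n. B * norm (g (v k) - g (u k)) + M * L * (v k - u k))"
        by (intro sum_mono pt) (use uv in auto)
      also have "\<dots> = B * (\<Sum>k<n. norm (g (v k) - g (u k))) + M * L * (\<Sum>k<n. v k - u k)"
        by (simp add: sum.distrib sum_distrib_left)
      also have "\<dots> < B * (\<epsilon> / (2 * B)) + M * L * (\<epsilon> / (2 * M * L))"
        by (intro add_strict_mono mult_strict_left_mono) (use \<delta> uv B M L in auto)
      also have "\<dots> = \<epsilon>" using B M L by (simp add: field_simps)
      finally show "(\<Sum>k<n. norm (\<phi> (v k) * g (v k) - \<phi> (u k) * g (u k))) < \<epsilon>" .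
    qed
  qed
qed

text \<open>The open intervals are pairwise disjoint, since at most endpoints are shared, so their
  lengths add up to the measure of a subset of \<open>T\<close>.\<close>

lemma sum_lengths_le_emeasure:
  fixes A :: "real set"
  assumes "finite A" "\<And>u. u \<in> A \<Longrightarrow> u \<le> V u" "\<And>u u'. \<lbrakk>u \<in> A; u' \<in> A; u < u'\<rbrakk> \<Longrightarrow> V u \<le> u'"
    and "\<And>u. u \<in> A \<Longrightarrow> {u<..<V u} \<subseteq> T" "T \<in> sets lebesgue"
  shows "ennreal (\<Sum>u\<in>A. V u - u) \<le> emeasure lebesgue T"
proof -
  have "ennreal (\<Sum>u\<in>A. V u - u) = (\<Sum>u\<in>A. emeasure lebesgue {u<..<V u})"
    using assms(2) by (subst sum_ennreal[symmetric]) (auto simp: sum_ennreal)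
  also have "\<dots> = emeasure lebesgue (\<Union>u\<in>A. {u<..<V u})"
    using assms(1,3)
    by (intro sum_emeasure) (fastforce simp: disjoint_family_on_def neq_iff)+
  also have "\<dots> \<le> emeasure lebesgue T"
    using assms(4,5) by (intro emeasure_mono) auto
  finally show ?thesis .
qed

text \<open>In the gauge definition of the integral, tags outside the null set \<open>N\<close> are controlled by
  differentiability; for tags in \<open>N\<close> the gauge forces the intervals into an open superset of \<open>N\<close> of
  small measure, where absolute continuity bounds the total increment.\<close>

theorem abs_cont_has_integral_deriv:
  assumes "a \<le> b" and ac: "abs_cont_on_interval g a b" and N: "negligible N"
    and der: "\<And>t. t \<in> {a..b} - N \<Longrightarrow> (g has_vector_derivative g' t) (at t within {a..b})"
  shows "(g' has_integral (g b - g a)) {a..b}"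
proof -
  \<comment> \<open>Setting the integrand to 0 on \<open>N\<close> leaves only the increment of
    \<open>g\<close> for tags in \<open>N\<close>.\<close>
  define h where "h = (\<lambda>t. if t \<in> N then 0 else g' t)"
  have "(h has_integral (g b - g a)) {a..b}"
    unfolding has_integral_real
  proof (intro allI impI)
    fix e :: real assume "e > 0"
    \<comment> \<open>Errors proportional to length then total \<open>c * (b - a) < e / 2\<close>;
      the \<open>+ 1\<close> keeps the denominator positive when \<open>a = b\<close>.\<close>
    define c where "c = e / (2 * (b - a + 1))"
    have "c > 0" using \<open>e > 0\<close> \<open>a \<le> b\<close> by (simp add: c_def)
    have "\<exists>d>0. x \<in> {a..b} - N \<longrightarrow>
         (\<forall>y\<in>{a..b}. norm (y-x) < d \<longrightarrow> norm (g y - g x - (y-x) *\<^sub>R g' x) \<le> c * norm (y-x))" for x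
      using der[of x] \<open>c > 0\<close>
      unfolding has_vector_derivative_def has_derivative_within_alt by (metis zero_less_one)
    then obtain d where d: "\<And>x. 0 < d x"
       "\<And>x y. \<lbrakk>x \<in> {a..b} - N; y \<in> {a..b}; norm (y-x) < d x\<rbrakk>
                        \<Longrightarrow> norm (g y - g x - (y-x) *\<^sub>R g' x) \<le> c * norm (y-x)"
      by metis
    obtain \<delta> where "0 < \<delta>" and \<delta>: "\<And>A V. \<lbrakk>finite A; \<And>u. u \<in> A \<Longrightarrow> a \<le> u \<and> u \<le> V u \<and> V u \<le> b;
        \<And>u u'. \<lbrakk>u \<in> A; u' \<in> A; u < u'\<rbrakk> \<Longrightarrow> V u \<le> u'; (\<Sum>u\<in>A. V u - u) < \<delta>\<rbrakk>
        \<Longrightarrow> (\<Sum>u\<in>A. norm (g (V u) - g u)) < e / 2"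
      using abs_cont_on_interval_finite_set[OF ac half_gt_zero[OF \<open>0 < e\<close>]] by blast
    have N0: "N \<in> null_sets lebesgue" using N negligible_iff_null_sets by blast
    then obtain T where T: "open T" "N \<subseteq> T" "T - N \<in> lmeasurable" "emeasure lebesgue (T - N) < ennreal \<delta>"
      using sets_lebesgue_outer_open[OF _ \<open>0 < \<delta>\<close>, of N] by blast
    have "T \<in> sets lebesgue" using T(1) by auto
    \<comment> \<open>Outer regularity bounds the measure of \<open>T - N\<close>; as
      \<open>N\<close> is null, the bound passes to \<open>T\<close>.\<close>
    then have Tsmall: "emeasure lebesgue T < ennreal \<delta>"
      using T(4) emeasure_Diff_null_set[OF N0] by simp
    define \<gamma> where "\<gamma> = (\<lambda>x. if x \<in> N then T else ball x (d x))"
    show "\<exists>\<gamma>. gauge \<gamma> \<and> (\<forall>\<D>. \<D> tagged_division_of {a..b} \<and> \<gamma> fine \<D> \<longrightarrow>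
        norm (sum (\<lambda>(x,k). measure lborel k *\<^sub>R h x) \<D> - (g b - g a)) < e)"
    proof (intro exI conjI allI impI; (elim conjE)?)
      show "gauge \<gamma>" using T d(1) by (auto simp: gauge_def \<gamma>_def)
    next
      fix p assume p: "p tagged_division_of {a..b}" and fine: "\<gamma> fine p"
      have fin: "finite p" using p by blast
      have pK: "\<exists>u v. K = {u..v} \<and> a \<le> u \<and> u \<le> x \<and> x \<le> v \<and> v \<le> b" if "(x, K) \<in> p" for x K
        using tagged_division_ofD(2-4)[OF p that] by auto
      \<comment> \<open>Degenerate intervals with tag in \<open>N\<close> are left out: their
        contribution is zero, and without them distinct intervals have distinct left
        endpoints.\<close>
      define p1 where "p1 = {(x, K). (x, K) \<in> p \<and> x \<in> N \<and> Inf K < Sup K}"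
      define p0 where "p0 = {(x, K). (x, K) \<in> p \<and> x \<notin> N}"
      let ?\<Delta> = "\<lambda>(x, K). measure lborel K *\<^sub>R h x - (g (Sup K) - g (Inf K))"
      have sub: "p0 \<union> p1 \<subseteq> p" "p0 \<inter> p1 = {}" by (auto simp: p0_def p1_def)
      have "sum (\<lambda>(x,k). measure lborel k *\<^sub>R h x) p - (g b - g a) = sum ?\<Delta> p"
        using additive_tagged_division_1[OF \<open>a \<le> b\<close> p, of g]
        by (simp add: sum_subtractf case_prod_unfold)
      also have "\<dots> = sum ?\<Delta> (p0 \<union> p1)"
      proof (rule sum.mono_neutral_right[OF fin sub(1)], intro ballI)
        fix q assume "q \<in> p - (p0 \<union> p1)"
        then obtain x K where xK: "q = (x, K)" "(x, K) \<in> p" "(x, K) \<notin> p0" "(x, K) \<notin> p1"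
          by (cases q) auto
        obtain u v where uv: "K = {u..v}" "u \<le> v" using pK[OF xK(2)] by force
        show "?\<Delta> q = 0"
          using xK uv by (cases "u = v") (auto simp: p0_def p1_def h_def)
      qed
      also have "\<dots> = sum ?\<Delta> p0 + sum ?\<Delta> p1"
        using sub fin by (intro sum.union_disjoint) (auto intro: finite_subset)
      finally have eq: "sum (\<lambda>(x,k). measure lborel k *\<^sub>R h x) p - (g b - g a) = sum ?\<Delta> p0 + sum ?\<Delta> p1" .
      \<comment> \<open>Straddle estimate: the increment over an interval is split at its tag, and
        the differentiability bound is used at both ends.\<close>
      have "norm (sum ?\<Delta> p0) \<le> (\<Sum>(x, K)\<in>p0. c * (Sup K - Inf K))"
      proof (rule sum_norm_le, clarify)
        fix x K assume "(x, K) \<in> p0"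
        then have xK: "(x, K) \<in> p" "x \<notin> N" by (auto simp: p0_def)
        then obtain u v where uv: "K = {u..v}" "a \<le> u" "u \<le> x" "x \<le> v" "v \<le> b"
          using pK by blast
        have "K \<subseteq> ball x (d x)" using fineD[OF fine xK(1)] xK(2) by (simp add: \<gamma>_def)
        moreover have "u \<in> K" "v \<in> K" using uv by auto
        ultimately have "u \<in> ball x (d x)" "v \<in> ball x (d x)" by auto
        then have "norm (g u - g x - (u-x) *\<^sub>R g' x) \<le> c * norm (u-x)"
           "norm (g v - g x - (v-x) *\<^sub>R g' x) \<le> c * norm (v-x)"
          using xK uv d(2)[of x u] d(2)[of x v] by (auto simp: dist_real_def)
        moreover have "measure lborel K *\<^sub>R h x - (g (Sup K) - g (Inf K)) =
            (g u - g x - (u-x) *\<^sub>R g' x) - (g v - g x - (v-x) *\<^sub>R g' x)"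
          using uv xK by (simp add: h_def algebra_simps)
        ultimately have "norm (measure lborel K *\<^sub>R h x - (g (Sup K) - g (Inf K))) \<le> c * norm (u-x) + c * norm (v-x)"
          by (smt (verit) norm_triangle_ineq4)
        also have "\<dots> = c * (Sup K - Inf K)" using uv by (simp add: algebra_simps)
        finally show "norm (measure lborel K *\<^sub>R h x - (g (Sup K) - g (Inf K))) \<le> c * (Sup K - Inf K)" .
      qed
      also have "\<dots> \<le> (\<Sum>(x, K)\<in>p. c * (Sup K - Inf K))"
      proof (rule sum_mono2[OF fin])
        show "0 \<le> (case q of (x, K) \<Rightarrow> c * (Sup K - Inf K))" if "q \<in> p - p0" for q
          using that pK[of "fst q" "snd q"] \<open>c > 0\<close> by (cases q) auto
      qed (use sub in auto)
      also have "\<dots> = c * (b - a)"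
        using additive_tagged_division_1[OF \<open>a \<le> b\<close> p, of "\<lambda>x. x"]
        by (simp add: case_prod_unfold flip: sum_distrib_left)
      also have "\<dots> < e / 2" using \<open>e > 0\<close> \<open>a \<le> b\<close> by (simp add: c_def field_simps)
      finally have 0: "norm (sum ?\<Delta> p0) < e / 2" .
      have p1: "(x, K) \<in> p" "x \<in> N" "K \<subseteq> T" "K = {Inf K..Sup K}" "Inf K < Sup K" "a \<le> Inf K" "Sup K \<le> b"
        if "(x, K) \<in> p1" for x K
        using that pK[of x K] fineD[OF fine, of x K] by (auto simp: p1_def \<gamma>_def)
      have sep: "Sup K \<le> Inf K'" if "(x, K) \<in> p1" "(x', K') \<in> p1" "(x, K) \<noteq> (x', K')" "Inf K \<le> Inf K'" for x K x' K'
      proof (rule ccontr)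
        assume "\<not> Sup K \<le> Inf K'"
        then have lt: "Inf K' < min (Sup K) (Sup K')" using p1 that by simp
        then obtain y where y: "Inf K' < y" "y < min (Sup K) (Sup K')" using dense by blast
        have "interior K \<inter> interior K' = {}"
          using tagged_division_ofD(5)[OF p p1(1)[OF that(1)] p1(1)[OF that(2)] that(3)] .
        moreover have "y \<in> interior {Inf K..Sup K}" "y \<in> interior {Inf K'..Sup K'}"
          using y that(4) by (auto simp: interior_atLeastAtMost_real)
        ultimately show False using p1(4)[OF that(1)] p1(4)[OF that(2)] by auto
      qed
      \<comment> \<open>Two nondegenerate intervals with a common left endpoint would overlap in
        their interiors.\<close>
      have inj: "inj_on (\<lambda>(x, K). Inf K) p1"
      proof (rule inj_onI, clarify)
        fix x K x' K' assume *: "(x, K) \<in> p1" "(x', K') \<in> p1" "Inf K = Inf K'"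
        then show "x = x' \<and> K = K'" using sep[OF *(1,2)] p1(5)[OF *(1)] by (cases "x = x'"; cases "K = K'") auto
      qed
      \<comment> \<open>The family is handed to absolute continuity as its set of left endpoints; by
        injectivity \<open>V\<close> can recover the right endpoint from the left one.\<close>
      define A where "A = (\<lambda>(x, K). Inf K) ` p1"
      define V where "V = (\<lambda>u. Sup (snd (inv_into p1 (\<lambda>(x, K). Inf K) u)))"
      have V: "V (Inf K) = Sup K" if "(x, K) \<in> p1" for x K
        using inv_into_f_f[OF inj that] by (simp add: V_def)
      have sumA: "(\<Sum>u\<in>A. f u (V u)) = (\<Sum>(x, K)\<in>p1. f (Inf K) (Sup K))" for f :: "real \<Rightarrow> real \<Rightarrow> real"
        unfolding A_def by (subst sum.reindex[OF inj]) (auto intro!: sum.cong simp: V)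
      have finA: "finite A" unfolding A_def using finite_subset[of p1 p] sub fin by auto
      have A_cases: "\<exists>x K. (x, K) \<in> p1 \<and> u = Inf K \<and> V u = Sup K" if "u \<in> A" for u
        using that V by (auto simp: A_def)
      have A1: "a \<le> u \<and> u \<le> V u \<and> V u \<le> b" if "u \<in> A" for u
        using A_cases[OF that] p1(5-7) less_imp_le by metis
      have A2: "V u \<le> u'" if "u \<in> A" "u' \<in> A" "u < u'" for u u'
        using A_cases[OF that(1)] A_cases[OF that(2)] sep that(3) by (metis less_imp_le less_irrefl prod.inject)
      have A3: "{u<..<V u} \<subseteq> T" if "u \<in> A" for u
      proof -
        obtain x K where xK: "(x, K) \<in> p1" "u = Inf K" "V u = Sup K" using A_cases[OF \<open>u \<in> A\<close>] by blast
        have "{u..V u} = K" unfolding xK(3) unfolding xK(2) using p1(4)[OF xK(1)] by (rule sym)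
        then show ?thesis using p1(3)[OF xK(1)] greaterThanLessThan_subseteq_atLeastAtMost_iff by fastforce
      qed
      have "ennreal (\<Sum>u\<in>A. V u - u) \<le> emeasure lebesgue T"
        using A1 by (intro sum_lengths_le_emeasure[OF finA _ A2 A3 \<open>T \<in> sets lebesgue\<close>]) auto
      also note Tsmall
      finally have "(\<Sum>u\<in>A. V u - u) < \<delta>"
        using A1 by (subst (asm) ennreal_less_iff) (auto intro!: sum_nonneg)
      then have "(\<Sum>u\<in>A. norm (g (V u) - g u)) < e / 2"
        using \<delta>[OF finA A1 A2] by blast
      moreover have "norm (sum ?\<Delta> p1) \<le> (\<Sum>(x, K)\<in>p1. norm (g (Sup K) - g (Inf K)))"
        by (rule sum_norm_le) (auto simp: p1_def h_def norm_minus_commute)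
      ultimately have 1: "norm (sum ?\<Delta> p1) < e / 2"
        using sumA[of "\<lambda>u v. norm (g v - g u)"] by simp
      show "norm (sum (\<lambda>(x,k). measure lborel k *\<^sub>R h x) p - (g b - g a)) < e"
        unfolding eq using 0 1 by (smt (verit) field_sum_of_halves norm_triangle_ineq)
    qed
  qed
  then show ?thesis
    by (rule has_integral_spike[OF N, rotated]) (simp add: h_def)
qed

section \<open>The Poisson kernel and Cauchy integrals on the circle\<close>

lemma one_minus_cis_nonzero: "cmod z < 1 \<Longrightarrow> 1 - z * cis t \<noteq> 0"
  by (metis eq_iff_diff_eq_0 less_irrefl mult.right_neutral norm_cis norm_mult norm_one)

text \<open>Partial fractions: with \<open>w = z * cis (-t)\<close>, the numerator 1 - |w|^2 equals
  \<open>(1 - w) + (1 - cnj w) - (1 - w) * (1 - cnj w)\<close>. The kernel thus splits into a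
  holomorphic, an antiholomorphic and a constant part in \<open>z\<close>, which reduces Poisson
  integrals to Cauchy integrals.\<close>

lemma poisson_kernel_eq:
  assumes "cmod z < 1"
  shows "complex_of_real (poisson_kernel z t) =
    (1 / (1 - z * cis (-t)) + 1 / (1 - cnj z * cis t) - 1) / (2 * pi)"
proof -
  define w where "w = z * cis (-t)"
  have cnj: "cnj w = cnj z * cis t" by (simp add: w_def cis_cnj)
  have "cmod w = cmod z" by (simp add: w_def norm_mult)
  then have 1: "complex_of_real ((cmod z)\<^sup>2) = w * cnj w" by (metis complex_norm_square)
  have 2: "complex_of_real ((cmod (1 - w))\<^sup>2) = (1 - w) * (1 - cnj w)"
    by (metis complex_cnj_diff complex_cnj_one complex_norm_square)
  have "1 - w \<noteq> 0" "1 - cnj w \<noteq> 0"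
    unfolding w_def cnj[unfolded w_def] using assms by (simp_all only: one_minus_cis_nonzero complex_mod_cnj not_False_eq_True)
  moreover have "(a + b - a * b) / (a * b) = 1 / a + 1 / b - 1" if "a \<noteq> 0" "b \<noteq> 0" for a b :: complex
    using that by (simp add: field_simps)
  moreover have "1 - w * cnj w = (1 - w) + (1 - cnj w) - (1 - w) * (1 - cnj w)"
    by (simp add: algebra_simps)
  ultimately have "(1 - w * cnj w) / ((1 - w) * (1 - cnj w)) = 1 / (1 - w) + 1 / (1 - cnj w) - 1"
    by (simp only: not_False_eq_True)
  moreover have "complex_of_real (poisson_kernel z t) = (1 - w * cnj w) / ((1 - w) * (1 - cnj w)) / (2 * pi)"
    unfolding poisson_kernel_def w_def[symmetric]
    by (simp only: of_real_divide of_real_mult of_real_diff of_real_1 1 2) simp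
  ultimately show ?thesis by (simp add: w_def cis_cnj)
qed

lemma poisson_kernel_nonneg: "cmod z < 1 \<Longrightarrow> 0 \<le> poisson_kernel z t"
  by (simp add: poisson_kernel_def abs_square_le_1)

lemma continuous_on_poisson_kernel:
  assumes "cmod z < 1"
  shows "continuous_on S (poisson_kernel z)"
  unfolding poisson_kernel_def using assms one_minus_cis_nonzero
  by (auto intro!: continuous_intros)

text \<open>Differentiation under the integral sign, justified by joint continuity of the
  differentiated integrand. The exponent is general because \<open>m = 1\<close> yields the
  derivative of a Cauchy integral and \<open>m = 2\<close> the holomorphy of that
  derivative.\<close>

lemma cauchy_integral_circle_has_field_derivative:
  assumes "continuous_on {0..2*pi} A" "cmod z < 1"
  shows "((\<lambda>z. integral {0..2*pi} (\<lambda>t. A t / (1 - z * cis (-t)) ^ m)) has_field_derivative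
     integral {0..2*pi} (\<lambda>t. of_nat m * A t * cis (-t) / (1 - z * cis (-t)) ^ Suc m)) (at z)"
proof -
  have "((\<lambda>z. integral (cbox 0 (2*pi)) (\<lambda>t. A t / (1 - z * cis (-t)) ^ m)) has_field_derivative
     integral (cbox 0 (2*pi)) (\<lambda>t. of_nat m * A t * cis (-t) / (1 - z * cis (-t)) ^ Suc m)) (at z within ball 0 1)"
  proof (rule leibniz_rule_field_derivative)
    fix x t assume "x \<in> ball (0::complex) 1"
    then have "1 - x * cis (-t) \<noteq> 0" by (simp only: one_minus_cis_nonzero mem_ball dist_0_norm not_False_eq_True)
    moreover have "D \<noteq> 0 \<Longrightarrow> (0 * D ^ m - A t * (of_nat m * (- cis (-t) * D ^ (m - Suc 0)))) / (D ^ m * D ^ m)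
        = of_nat m * A t * cis (-t) / D ^ Suc m" for D
      by (cases m) (simp_all add: field_simps)
    moreover have "((\<lambda>z. 1 - z * cis (-t)) has_field_derivative - cis (-t)) (at x within ball 0 1)"
      by (auto intro!: derivative_eq_intros)
    ultimately show "((\<lambda>z. A t / (1 - z * cis (-t)) ^ m) has_field_derivative
         of_nat m * A t * cis (-t) / (1 - x * cis (-t)) ^ Suc m) (at x within ball 0 1)"
      using DERIV_divide[OF DERIV_const DERIV_power, of "\<lambda>z. 1 - z * cis (-t)" "- cis (-t)" x "ball 0 1" m "A t"]
      by simp
  next
    fix x assume "x \<in> ball (0::complex) 1"
    then have "1 - x * cis (-t) \<noteq> 0" for t by (simp only: one_minus_cis_nonzero mem_ball dist_0_norm not_False_eq_True)
    then show "(\<lambda>t. A t / (1 - x * cis (-t)) ^ m) integrable_on cbox 0 (2*pi)"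
      using assms by (intro integrable_continuous continuous_intros) auto
  next
    have "continuous_on (ball 0 1 \<times> cbox 0 (2*pi)) (\<lambda>x. A (snd x))"
      by (rule continuous_on_compose2[OF assms(1)]) (auto intro: continuous_intros)
    moreover have "1 - x * cis (-t) \<noteq> 0" if "x \<in> ball 0 1" for x t
      using that by (simp only: one_minus_cis_nonzero mem_ball dist_0_norm not_False_eq_True)
    ultimately show "continuous_on (ball 0 1 \<times> cbox 0 (2*pi))
        (\<lambda>(x, t). of_nat m * A t * cis (-t) / (1 - x * cis (-t)) ^ Suc m)"
      unfolding case_prod_unfold by (intro continuous_intros) auto
  qed (use assms in auto)
  then show ?thesis using assms by (simp add: at_within_open[of z "ball 0 1"])
qed

lemma has_vector_derivative_inverse_one_minus_cis:
  assumes "cmod z < 1"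
  shows "((\<lambda>t. 1 / (1 - z * cis (-t))) has_vector_derivative
     - (\<i> * z * cis (-t) / (1 - z * cis (-t))\<^sup>2)) (at t within S)"
proof -
  have "1 - z * exp (- (\<i> * complex_of_real t)) \<noteq> 0"
    using one_minus_cis_nonzero[OF assms, of "-t"] by (simp add: cis_conv_exp)
  then have "((\<lambda>w. 1 / (1 - z * exp (- (\<i> * w)))) has_field_derivative
     - (\<i> * z * exp (- (\<i> * of_real t)) / (1 - z * exp (- (\<i> * of_real t)))\<^sup>2)) (at (of_real t))"
    by (auto intro!: derivative_eq_intros simp: field_simps power2_eq_square)
  from has_vector_derivative_real_field[OF this] show ?thesis
    by (simp add: cis_conv_exp)
qed

text \<open>Integration by parts against the Cauchy kernel: its product with \<open>G\<close> is
  absolutely continuous, so the fundamental theorem applies, and the boundary terms cancel because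
  both factors take equal values at 0 and 2 pi.\<close>

lemma has_integral_cauchy_circle_deriv:
  assumes "abs_cont_on_interval G 0 (2*pi)" "G 0 = G (2*pi)" "negligible N"
    and der: "\<And>t. t \<in> {0..2*pi} - N \<Longrightarrow> (G has_vector_derivative g t) (at t within {0..2*pi})"
    and z: "cmod z < 1"
  shows "((\<lambda>t. g t / (1 - z * cis (-t))) has_integral
     \<i> * z * integral {0..2*pi} (\<lambda>t. G t * cis (-t) / (1 - z * cis (-t))\<^sup>2)) {0..2*pi}"
proof -
  note nz = one_minus_cis_nonzero[OF z]
  define \<phi> where "\<phi> = (\<lambda>t. 1 / (1 - z * cis (-t)))"
  define \<phi>' where "\<phi>' = (\<lambda>t. - (\<i> * z * cis (-t) / (1 - z * cis (-t))\<^sup>2))"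
  have d\<phi>: "(\<phi> has_vector_derivative \<phi>' t) (at t within {0..2*pi})" for t
    unfolding \<phi>_def \<phi>'_def by (rule has_vector_derivative_inverse_one_minus_cis[OF z])
  have c\<phi>: "continuous_on {0..2*pi} \<phi>'" unfolding \<phi>'_def
    using nz by (intro continuous_intros) auto
  have cG: "continuous_on {0..2*pi} G" using assms(1) by (rule abs_cont_on_interval_imp_continuous_on)
  have "((\<lambda>t. \<phi> t * g t + \<phi>' t * G t) has_integral \<phi> (2*pi) * G (2*pi) - \<phi> 0 * G 0) {0..2*pi}"
    by (rule abs_cont_has_integral_deriv[OF _ abs_cont_on_interval_mult_C1[OF assms(1) d\<phi> c\<phi>] assms(3)
          has_vector_derivative_mult[OF d\<phi> der]]) auto
  moreover have "\<phi> (2*pi) * G (2*pi) - \<phi> 0 * G 0 = 0"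
    using assms(2) by (simp add: \<phi>_def flip: cis_inverse)
  ultimately have "((\<lambda>t. \<phi> t * g t + \<phi>' t * G t) has_integral 0) {0..2*pi}" by simp
  moreover have "((\<lambda>t. \<phi>' t * G t) has_integral integral {0..2*pi} (\<lambda>t. \<phi>' t * G t)) {0..2*pi}"
    by (intro integrable_integral integrable_continuous_real continuous_intros c\<phi> cG)
  ultimately have "((\<lambda>t. \<phi> t * g t) has_integral 0 - integral {0..2*pi} (\<lambda>t. \<phi>' t * G t)) {0..2*pi}"
    by (drule_tac has_integral_diff) auto
  moreover have "integral {0..2*pi} (\<lambda>t. \<phi>' t * G t) =
     - (\<i> * z) * integral {0..2*pi} (\<lambda>t. G t * cis (-t) / (1 - z * cis (-t))\<^sup>2)"
    by (subst integral_mult_right[symmetric]) (simp add: \<phi>'_def mult_ac)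
  ultimately show ?thesis by (simp add: \<phi>_def)
qed

text \<open>Integration by parts with the constant function 1 shows that the integral has derivative
  zero in \<open>z\<close>, so it keeps its value 2 pi at the origin.\<close>

lemma integral_cauchy_circle_one:
  assumes "cmod z < 1"
  shows "((\<lambda>t. 1 / (1 - z * cis (-t))) has_integral 2 * pi) {0..2*pi}"
proof -
  define H where "H = (\<lambda>z. integral {0..2*pi} (\<lambda>t. 1 / (1 - z * cis (-t))))"
  have "(H has_field_derivative 0) (at z)" if z: "cmod z < 1" for z
  proof -
    have "integral {0..2*pi} (\<lambda>t. cis (-t) / (1 - z * cis (-t))\<^sup>2) = 0"
    \<comment> \<open>Integration by parts controls only \<open>z\<close> times this integral, so
      the origin needs an explicit antiderivative.\<close>
    proof (cases "z = 0")
      case True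
      have "((\<lambda>t. \<i> * cis (-t)) has_vector_derivative cis (-t)) (at t within {0..2*pi})" for t
      proof -
        have "((\<lambda>w. \<i> * exp (- (\<i> * w))) has_field_derivative exp (- (\<i> * of_real t))) (at (of_real t))"
          by (auto intro!: derivative_eq_intros simp: mult.assoc)
        from has_vector_derivative_real_field[OF this] show ?thesis by (simp add: cis_conv_exp)
      qed
      then have "((\<lambda>t. cis (-t)) has_integral \<i> * cis (-(2*pi)) - \<i> * cis (-0)) {0..2*pi}"
        by (intro fundamental_theorem_of_calculus) auto
      then show ?thesis using True by (simp add: integral_unique flip: cis_inverse)
    next
      case False
      have "((\<lambda>t. 0 / (1 - z * cis (-t))) has_integral
         \<i> * z * integral {0..2*pi} (\<lambda>t. 1 * cis (-t) / (1 - z * cis (-t))\<^sup>2)) {0..2*pi}"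
        by (rule has_integral_cauchy_circle_deriv[where N = "{}"])
          (use z in \<open>auto simp: abs_cont_on_interval_def intro: exI[of _ 1]\<close>)
      then have "\<i> * z * integral {0..2*pi} (\<lambda>t. 1 * cis (-t) / (1 - z * cis (-t))\<^sup>2) = 0"
        using has_integral_unique[OF _ has_integral_0] by (metis (no_types, lifting) div_0 has_integral_cong)
      then show ?thesis using False by simp
    qed
    then show ?thesis
      using cauchy_integral_circle_has_field_derivative[of "\<lambda>_. 1" z 1] z
      by (simp add: H_def power2_eq_square)
  qed
  then have "\<exists>c. \<forall>z\<in>ball 0 1. H z = c"
    by (intro has_field_derivative_zero_constant) (auto intro: has_field_derivative_at_within)
  then have "H z = H 0" using assms by fastforce
  moreover have "H 0 = 2 * pi" by (simp add: H_def scaleR_conv_of_real)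
  moreover have "(\<lambda>t. 1 / (1 - z * cis (-t))) integrable_on {0..2*pi}"
    using one_minus_cis_nonzero[OF assms] by (intro integrable_continuous_real continuous_intros) auto
  ultimately show ?thesis unfolding H_def by (metis has_integral_integral)
qed

text \<open>By the partial fraction form the mass is (2 pi + 2 pi - 2 pi) / (2 pi), the second term
  being the conjugate of the first.\<close>

lemma poisson_kernel_has_integral_one:
  assumes "cmod z < 1"
  shows "(poisson_kernel z has_integral 1) {0..2*pi}"
proof -
  note H = integral_cauchy_circle_one[OF assms]
  have "((\<lambda>t. Re ((1 / (1 - z * cis (-t)) + cnj (1 / (1 - z * cis (-t))) - 1) / (2 * pi))) has_integral
     Re ((complex_of_real (2 * pi) + cnj (complex_of_real (2 * pi)) - complex_of_real (2 * pi)) / (2 * pi))) {0..2*pi}"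
    using has_integral_const_real[of "1::complex" 0 "2*pi"]
    by (intro has_integral_linear[OF _ bounded_linear_Re, unfolded o_def] has_integral_divide
        has_integral_diff has_integral_add has_integral_linear[OF _ bounded_linear_cnj, unfolded o_def] H)
      (simp add: scaleR_conv_of_real)
  moreover have "Re ((1 / (1 - z * cis (-t)) + cnj (1 / (1 - z * cis (-t))) - 1) / (2 * pi)) = poisson_kernel z t" for t
  proof -
    have "(1 / (1 - z * cis (-t)) + cnj (1 / (1 - z * cis (-t))) - 1) / (2 * pi) = complex_of_real (poisson_kernel z t)"
      unfolding poisson_kernel_eq[OF assms] by (simp add: cis_cnj)
    then show ?thesis by (metis Re_complex_of_real)
  qed
  ultimately show ?thesis by simp
qed

section \<open>Hardy spaces and Poisson majorants\<close>

text \<open>Convexity of x^q on the positive half-line; this is the pointwise input for Jensen's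
  inequality.\<close>

lemma powr_above_tangent:
  fixes a x q :: real
  assumes "1 \<le> q" "0 < a" "0 \<le> x"
  shows "a powr q + q * a powr (q - 1) * (x - a) \<le> x powr q"
\<comment> \<open>Convexity is used on the open half-line only; at 0 the claim reduces to (1 - q)
  a^q \<le> 0.\<close>
proof (cases "x = 0")
  case True
  have "a powr (q - 1) * a = a powr q" using assms by (simp add: powr_diff)
  then have "a powr q + q * a powr (q - 1) * (x - a) = (1 - q) * a powr q"
    using True by (simp add: algebra_simps)
  also have "\<dots> \<le> 0" using assms by (simp add: mult_nonpos_nonneg)
  finally show ?thesis using True by simp
next
  case False
  have "convex_on {0<..} (\<lambda>x. x powr q)"
    using assms(1) by (rule powr_convex)
  then have "x powr q - a powr q \<ge> (q * a powr (q - 1)) * (x - a)"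
    using has_field_derivative_at_within[OF has_real_derivative_powr[OF \<open>0 < a\<close>], of q]
    by (rule_tac convex_on_imp_above_tangent) (use assms False in \<open>auto simp: interior_open\<close>)
  then show ?thesis by simp
qed

text \<open>The kernel is continuous, hence measurable and bounded on the compact interval.\<close>

lemma poisson_kernel_mult_absolutely_integrable:
  fixes w :: "real \<Rightarrow> 'a::euclidean_space"
  assumes "cmod z < 1" "w absolutely_integrable_on {0..2*pi}"
  shows "(\<lambda>t. poisson_kernel z t *\<^sub>R w t) absolutely_integrable_on {0..2*pi}"
proof (rule absolutely_integrable_bounded_measurable_product[where h = "(*\<^sub>R)"])
  have c: "continuous_on {0..2*pi} (poisson_kernel z)"
    using assms(1) by (rule continuous_on_poisson_kernel)
  show "poisson_kernel z \<in> borel_measurable (lebesgue_on {0..2*pi})"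
    by (rule continuous_imp_measurable_on_sets_lebesgue[OF c]) auto
  show "bounded (poisson_kernel z ` {0..2*pi})"
    by (rule compact_imp_bounded[OF compact_continuous_image[OF c]]) auto
  show "bilinear ((*\<^sub>R) :: real \<Rightarrow> 'a \<Rightarrow> 'a)"
    by (simp add: bilinear_conv_bounded_bilinear bounded_bilinear_scaleR)
qed (use assms in auto)

text \<open>Jensen's inequality for the probability measure with density
  \<open>poisson_kernel z\<close> on the circle.\<close>

lemma poisson_jensen:
  fixes w :: "real \<Rightarrow> real"
  assumes z: "cmod z < 1" and "1 \<le> q" and nonneg: "\<And>t. 0 \<le> w t"
    and w: "w absolutely_integrable_on {0..2*pi}"
    and wq: "(\<lambda>t. w t powr q) absolutely_integrable_on {0..2*pi}"
  shows "integral {0..2*pi} (\<lambda>t. poisson_kernel z t * w t) powr q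
    \<le> integral {0..2*pi} (\<lambda>t. poisson_kernel z t * w t powr q)"
proof -
  define a where "a = integral {0..2*pi} (\<lambda>t. poisson_kernel z t * w t)"
  note int = poisson_kernel_mult_absolutely_integrable[OF z w, unfolded real_scaleR_def, THEN set_lebesgue_integral_eq_integral(1)]
  note intq = poisson_kernel_mult_absolutely_integrable[OF z wq, unfolded real_scaleR_def, THEN set_lebesgue_integral_eq_integral(1)]
  have "a \<ge> 0" unfolding a_def
    by (intro integral_nonneg int) (auto intro: mult_nonneg_nonneg poisson_kernel_nonneg z nonneg)
  show ?thesis
  \<comment> \<open>The tangent inequality at \<open>a\<close> requires \<open>a > 0\<close>; for
    \<open>a = 0\<close> the left side vanishes.\<close>
  proof (cases "a = 0")
    case True
    have "0 \<le> integral {0..2*pi} (\<lambda>t. poisson_kernel z t * w t powr q)"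
      by (intro integral_nonneg intq mult_nonneg_nonneg poisson_kernel_nonneg z powr_ge_zero)
    then show ?thesis using True by (simp flip: a_def)
  next
    case False
    txt \<open>Integrate the tangent line inequality at the mean value \<open>a\<close>; the linear term vanishes.\<close>
    have "((\<lambda>t. a powr q * poisson_kernel z t + q * a powr (q - 1) * (poisson_kernel z t * w t - a * poisson_kernel z t))
       has_integral (a powr q * 1 + q * a powr (q - 1) * (a - a * 1))) {0..2*pi}"
      using integrable_integral[OF int] unfolding a_def[symmetric]
      by (intro has_integral_add has_integral_mult_right has_integral_diff poisson_kernel_has_integral_one[OF z])
    then have "((\<lambda>t. poisson_kernel z t * (a powr q + q * a powr (q - 1) * (w t - a))) has_integral a powr q) {0..2*pi}"
      by (simp add: algebra_simps)
    then have "a powr q \<le> integral {0..2*pi} (\<lambda>t. poisson_kernel z t * w t powr q)"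
      using integrable_integral[OF intq]
      by (rule has_integral_le)
        (use \<open>a \<ge> 0\<close> False assms in \<open>auto intro!: mult_left_mono powr_above_tangent poisson_kernel_nonneg\<close>)
    then show ?thesis by (simp add: a_def)
  qed
qed

section \<open>Circle means of Poisson integrals\<close>

text \<open>Conjugation exchanges \<open>s\<close> and \<open>t\<close> and preserves the modulus in
  the denominator. Hence the kernel has mass one also as a function of the angle of the inner
  point.\<close>

lemma poisson_kernel_swap: "poisson_kernel (of_real r * cis s) t = poisson_kernel (of_real r * cis t) s"
proof -
  have "of_real r * cis s * cis (-t) = cnj (of_real r * cis t * cis (-s))"
    by (simp add: cis_mult cis_cnj)
  then have "cmod (1 - of_real r * cis s * cis (-t)) = cmod (1 - of_real r * cis t * cis (-s))"
    by (metis complex_cnj_diff complex_cnj_one complex_mod_cnj)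
  then show ?thesis by (simp add: poisson_kernel_def norm_mult)
qed

lemma poisson_kernel_circle_measurable:
  assumes "\<bar>r\<bar> < 1"
  shows "(\<lambda>(s, t). poisson_kernel (of_real r * cis s) t) \<in> borel_measurable (lborel \<Otimes>\<^sub>M lborel)"
proof -
  have nz: "1 - of_real r * cis s * cis (-t) \<noteq> 0" for s t
    using assms by (intro one_minus_cis_nonzero) (simp add: norm_mult)
  have "continuous_on UNIV (\<lambda>x. poisson_kernel (of_real r * cis (fst x)) (snd x))"
    unfolding poisson_kernel_def using nz by (intro continuous_intros) auto
  then have "(\<lambda>x. poisson_kernel (of_real r * cis (fst x)) (snd x)) \<in> borel_measurable borel"
    by (rule borel_measurable_continuous_onI)
  then show ?thesis by (simp add: case_prod_unfold lborel_prod)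
qed

text \<open>By Tonelli's theorem the Poisson integral of \<open>W\<close>, integrated over the angle
  \<open>s\<close>, gives the integral of \<open>W\<close>, because the kernel has mass one in
  \<open>s\<close>. The computation runs in \<open>nn_integral\<close>, where exchanging the order
  for nonnegative functions needs only measurability.\<close>

lemma integral_poisson_le:
  fixes W :: "real \<Rightarrow> real" and u :: "real \<Rightarrow> real"
  assumes r: "\<bar>r\<bar> < 1" and nonneg: "\<And>t. 0 \<le> W t" and W: "W absolutely_integrable_on {0..2*pi}"
    and u: "u integrable_on {0..2*pi}" "\<And>s. 0 \<le> u s"
    and le: "\<And>s. s \<in> {0..2*pi} \<Longrightarrow> u s \<le> integral {0..2*pi} (\<lambda>t. poisson_kernel (of_real r * cis s) t * W t)"
  shows "integral {0..2*pi} u \<le> integral {0..2*pi} W"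
proof -
  let ?I = "indicator {0..2*pi} :: real \<Rightarrow> ennreal"
  let ?P = "\<lambda>s t. poisson_kernel (of_real r * cis s) t"
  have rz: "cmod (of_real r * cis s) < 1" for s using r by (simp add: norm_mult)
  note [measurable] = poisson_kernel_circle_measurable[OF r]
  have iW: "W integrable_on {0..2*pi}" using W by (rule set_lebesgue_integral_eq_integral(1))
  have "(\<lambda>t. indicator {0..2*pi} t *\<^sub>R W t) \<in> borel_measurable lebesgue"
    using W by (auto simp: set_integrable_def)
  \<comment> \<open>\<open>W\<close> is only Lebesgue measurable; a Borel representative makes the
    integrand measurable for the product of Borel measures.\<close>
  then obtain V where [measurable]: "V \<in> borel_measurable lborel"
    and V: "AE t in lborel. indicator {0..2*pi} t *\<^sub>R W t = V t"
    using completion_ex_borel_measurable_real by blast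
  have V': "AE t in lborel. ennreal (c t * W t) * ?I t = ennreal (c t) * (ennreal (V t) * ?I t)"
    if "\<And>t. 0 \<le> c t" for c
    using V by eventually_elim (use that nonneg in \<open>auto simp: indicator_def ennreal_mult\<close>)
  have "ennreal (integral {0..2*pi} u) = (\<integral>\<^sup>+s. ennreal (u s) * ?I s \<partial>lborel)"
    using nn_integral_has_integral_lebesgue'[OF u(2) integrable_integral[OF u(1)]] by simp
  also have "\<dots> \<le> (\<integral>\<^sup>+s. \<integral>\<^sup>+t. ennreal (?P s t) * (ennreal (V t) * ?I t) * ?I s \<partial>lborel \<partial>lborel)"
  proof (rule nn_integral_mono)
    fix s
    have "(\<lambda>t. ?P s t * W t) integrable_on {0..2*pi}"
      using poisson_kernel_mult_absolutely_integrable[OF rz W, of s]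
      by (auto dest: set_lebesgue_integral_eq_integral(1))
    then have "ennreal (integral {0..2*pi} (\<lambda>t. ?P s t * W t)) = (\<integral>\<^sup>+t. ennreal (?P s t * W t) * ?I t \<partial>lborel)"
      using nn_integral_has_integral_lebesgue'[OF _ integrable_integral, of "{0..2*pi}" "\<lambda>t. ?P s t * W t"]
        nonneg poisson_kernel_nonneg[OF rz] by simp
    also have "\<dots> = (\<integral>\<^sup>+t. ennreal (?P s t) * (ennreal (V t) * ?I t) \<partial>lborel)"
      by (rule nn_integral_cong_AE[OF V']) (rule poisson_kernel_nonneg[OF rz])
    finally have eq: "ennreal (integral {0..2*pi} (\<lambda>t. ?P s t * W t)) = \<dots>" .
    have "ennreal (u s) * ?I s \<le> (\<integral>\<^sup>+t. ennreal (?P s t) * (ennreal (V t) * ?I t) \<partial>lborel) * ?I s"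
      unfolding eq[symmetric] using le[of s] by (auto simp: indicator_def intro: ennreal_leI)
    also have "\<dots> = (\<integral>\<^sup>+t. ennreal (?P s t) * (ennreal (V t) * ?I t) * ?I s \<partial>lborel)"
      by (rule nn_integral_multc[symmetric]) measurable
    finally show "ennreal (u s) * ?I s \<le> \<dots>" .
  qed
  also have "\<dots> = (\<integral>\<^sup>+t. \<integral>\<^sup>+s. ennreal (?P s t) * (ennreal (V t) * ?I t) * ?I s \<partial>lborel \<partial>lborel)"
    by (rule lborel_pair.Fubini') measurable
  also have "\<dots> = (\<integral>\<^sup>+t. ennreal (V t) * ?I t \<partial>lborel)"
  proof (rule nn_integral_cong)
    fix t
    have "(\<integral>\<^sup>+s. ennreal (?P s t) * (ennreal (V t) * ?I t) * ?I s \<partial>lborel)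
        = (\<integral>\<^sup>+s. ennreal (?P s t) * ?I s \<partial>lborel) * (ennreal (V t) * ?I t)"
      by (subst nn_integral_multc[symmetric]) (measurable, simp add: mult_ac)
    \<comment> \<open>Symmetry turns the integral over the angle of the inner point into one over
      the boundary variable, where the mass is known.\<close>
    also have "(\<integral>\<^sup>+s. ennreal (?P s t) * ?I s \<partial>lborel) = 1"
      unfolding poisson_kernel_swap[of r _ t]
      using nn_integral_has_integral_lebesgue'[OF poisson_kernel_nonneg[OF rz[of t]] poisson_kernel_has_integral_one[OF rz[of t]]] by simp
    finally show "(\<integral>\<^sup>+s. ennreal (?P s t) * (ennreal (V t) * ?I t) * ?I s \<partial>lborel) = ennreal (V t) * ?I t" by simp
  qed
  also have "\<dots> = (\<integral>\<^sup>+t. ennreal (W t) * ?I t \<partial>lborel)"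
    by (rule nn_integral_cong_AE) (use V'[of "\<lambda>_. 1"] in auto)
  also have "\<dots> = ennreal (integral {0..2*pi} W)"
    using nn_integral_has_integral_lebesgue'[OF nonneg integrable_integral[OF iW]] by simp
  finally show ?thesis
    using integral_nonneg[OF iW] nonneg by (simp add: ennreal_le_iff)
qed

section \<open>L^p functions on the circle and Hardy means\<close>

lemma one_le_imp_one_le_enn2real: "1 \<le> p \<Longrightarrow> p \<noteq> \<infinity> \<Longrightarrow> 1 \<le> enn2real p"
  by (cases p) (auto simp: ennreal_ge_1)


text \<open>The circle has finite measure, so L^p lies in L^1; for finite p this follows from |g|
  \<le> 1 + |g|^p.\<close>

lemma in_Lp_circle_absolutely_integrable:
  assumes "1 \<le> p" "in_Lp_circle p g"
  shows "g absolutely_integrable_on {0..2*pi}"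
proof -
  have meas: "g \<in> borel_measurable (lebesgue_on {0..2*pi})"
    using assms(2) by (simp add: in_Lp_circle_def measurable_on_iff_borel_measurable)
  show ?thesis
  proof (cases "p = \<infinity>")
    case True
    then obtain M where M: "AE t in lebesgue. t \<in> {0..2*pi} \<longrightarrow> norm (g t) \<le> M"
      using assms by (auto simp: in_Lp_circle_def)
    then obtain N where N: "negligible N" "\<And>t. t \<in> {0..2*pi} - N \<Longrightarrow> norm (g t) \<le> M"
      by (auto simp: negligible_iff_null_sets elim!: AE_E3)
    \<comment> \<open>The bound \<open>M\<close> may fail on \<open>N\<close>; using
      \<open>norm (g t)\<close> there gives a majorant valid at every point, still integrable
      because \<open>N\<close> is negligible.\<close>
    have "(\<lambda>t. if t \<in> N then norm (g t) else M) integrable_on {0..2*pi}"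
      by (rule integrable_spike[OF integrable_const_ivl[of M] N(1)]) auto
    then show ?thesis
      by (rule measurable_bounded_by_integrable_imp_absolutely_integrable[OF meas, rotated]) (use N in auto)
  next
    case False
    then have q: "1 \<le> enn2real p" using assms(1) by (rule_tac one_le_imp_one_le_enn2real)
    have "(\<lambda>t. 1 + norm (g t) powr enn2real p) integrable_on {0..2*pi}"
      using assms(2) False by (intro integrable_add) (auto simp: in_Lp_circle_def)
    moreover have "norm (g t) \<le> 1 + norm (g t) powr enn2real p" for t
    proof (cases "norm (g t) \<le> 1")
      case True
      then show ?thesis by (simp add: add_increasing2)
    next
      case False
      then have "norm (g t) powr 1 \<le> norm (g t) powr enn2real p"
        using q by (intro powr_mono) auto
      then show ?thesis using False by simp
    qed
    ultimately show ?thesis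
      by (intro measurable_bounded_by_integrable_imp_absolutely_integrable[OF meas]) auto
  qed
qed

text \<open>This places the final majorant, a multiple of |g| plus a constant, in L^p.\<close>

lemma in_Lp_circle_affine_norm:
  assumes "1 \<le> p" "in_Lp_circle p g" "0 \<le> a" "0 \<le> c"
  shows "in_Lp_circle p (\<lambda>t. complex_of_real (a * norm (g t) + c))"
proof -
  have meas [measurable]: "g \<in> borel_measurable (lebesgue_on {0..2*pi})"
    using assms(2) by (simp add: in_Lp_circle_def measurable_on_iff_borel_measurable)
  have "(\<lambda>t. complex_of_real (a * norm (g t) + c)) measurable_on {0..2*pi}"
    by (subst measurable_on_iff_borel_measurable) (simp, measurable)
  moreover have "\<exists>M. AE t in lebesgue. t \<in> {0..2*pi} \<longrightarrow> a * norm (g t) + c \<le> M" if p: "p = \<infinity>"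
  proof -
    obtain M where M: "AE t in lebesgue. t \<in> {0..2*pi} \<longrightarrow> norm (g t) \<le> M"
      using assms p by (auto simp: in_Lp_circle_def)
    have "AE t in lebesgue. t \<in> {0..2*pi} \<longrightarrow> a * norm (g t) + c \<le> a * M + c"
      using M by eventually_elim (use assms in \<open>auto intro: mult_left_mono\<close>)
    then show ?thesis by blast
  qed
  moreover have "(\<lambda>t. (a * norm (g t) + c) powr enn2real p) integrable_on {0..2*pi}" if p: "p \<noteq> \<infinity>"
  proof -
    define q where "q = enn2real p"
    have q: "1 \<le> q" using assms(1) p unfolding q_def by (rule one_le_imp_one_le_enn2real)
    have int: "(\<lambda>t. norm (g t) powr q) integrable_on {0..2*pi}"
      using assms(2) p by (auto simp: in_Lp_circle_def q_def)
    \<comment> \<open>A sum of nonnegative x and y is at most twice the larger, so its q-th power is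
      at most (2x)^q + (2y)^q.\<close>
    have "(\<lambda>t. (2 * a) powr q * norm (g t) powr q + (2 * c) powr q) integrable_on {0..2*pi}"
      by (intro integrable_add integrable_on_mult_right int integrable_const_ivl)
    moreover have "norm ((a * norm (g t) + c) powr q) \<le> (2 * a) powr q * norm (g t) powr q + (2 * c) powr q" for t
    proof (cases "a * norm (g t) \<le> c")
      case True
      then have "(a * norm (g t) + c) powr q \<le> (2 * c) powr q"
        using assms q by (intro powr_mono2) auto
      then show ?thesis by (simp add: add_increasing)
    next
      case False
      then have "(a * norm (g t) + c) powr q \<le> (2 * a * norm (g t)) powr q"
        using assms q by (intro powr_mono2) auto
      also have "\<dots> = (2 * a) powr q * norm (g t) powr q"
        using assms by (simp add: powr_mult)
      finally show ?thesis by (simp add: add_increasing2)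
    qed
    moreover have "(\<lambda>t. (a * norm (g t) + c) powr q) \<in> borel_measurable (lebesgue_on {0..2*pi})"
      by measurable
    ultimately have "(\<lambda>t. (a * norm (g t) + c) powr q) integrable_on {0..2*pi}"
      by (rule_tac measurable_bounded_by_integrable_imp_integrable) auto
    then show ?thesis by (simp add: q_def)
  qed
  moreover have "norm (complex_of_real (a * norm (g t) + c)) = a * norm (g t) + c" for t
    unfolding norm_of_real using assms by simp
  ultimately show ?thesis unfolding in_Lp_circle_def by simp
qed

text \<open>For finite p, Jensen's inequality moves the power onto \<open>w\<close>, and integrating
  over the circle bounds the means by the integral of \<open>w t powr q\<close>, independently of
  the radius. For p = \<infinity>, an essential bound of \<open>w\<close> passes to its Poisson
  integral because the kernel is nonnegative with mass one.\<close>

proposition hardy_if_poisson_majorant: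
  fixes w :: "real \<Rightarrow> real"
  assumes p: "1 \<le> p" and hol: "\<phi> holomorphic_on ball 0 1"
    and w: "in_Lp_circle p (\<lambda>t. complex_of_real (w t))" and nonneg: "\<And>t. 0 \<le> w t"
    and le: "\<And>z. cmod z < 1 \<Longrightarrow> cmod (\<phi> z) \<le> integral {0..2*pi} (\<lambda>t. poisson_kernel z t * w t)"
  shows "hardy p \<phi>"
proof -
  have aw: "w absolutely_integrable_on {0..2*pi}"
    using absolutely_integrable_linear[OF in_Lp_circle_absolutely_integrable[OF p w] bounded_linear_Re]
    by (simp add: o_def)
  show ?thesis
  proof (cases "p = \<infinity>")
    case True
    then obtain M where M: "AE t in lebesgue. t \<in> {0..2*pi} \<longrightarrow> w t \<le> M"
      using w nonneg by (auto simp: in_Lp_circle_def)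
    then obtain N where N: "negligible N" "\<And>t. t \<in> {0..2*pi} - N \<Longrightarrow> w t \<le> M"
      by (auto simp: negligible_iff_null_sets elim!: AE_E3)
    have "cmod (\<phi> z) \<le> M" if z: "cmod z < 1" for z
    proof -
      \<comment> \<open>\<open>P\<close> agrees with the integrand on \<open>N\<close>, so the
        comparison holds at every point and not just almost everywhere.\<close>
      define P where "P = (\<lambda>t. if t \<in> N then poisson_kernel z t * w t else poisson_kernel z t * M)"
      have "((\<lambda>t. poisson_kernel z t * M) has_integral M) {0..2*pi}"
        using has_integral_mult_left[OF poisson_kernel_has_integral_one[OF z], of M] by simp
      then have "(P has_integral M) {0..2*pi}"
        by (rule has_integral_spike[OF N(1), rotated]) (auto simp: P_def)
      moreover have "((\<lambda>t. poisson_kernel z t * w t) has_integral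
          integral {0..2*pi} (\<lambda>t. poisson_kernel z t * w t)) {0..2*pi}"
        using poisson_kernel_mult_absolutely_integrable[OF z aw]
        by (auto dest: set_lebesgue_integral_eq_integral(1))
      ultimately have "integral {0..2*pi} (\<lambda>t. poisson_kernel z t * w t) \<le> M"
        by (rule_tac has_integral_le) (use N z in \<open>auto simp: P_def intro!: mult_left_mono poisson_kernel_nonneg\<close>)
      with le[OF z] show ?thesis by simp
    qed
    then show ?thesis using hol True by (auto simp: hardy_def bounded_iff intro!: exI[of _ M])
  next
    case False
    define q where "q = enn2real p"
    have q: "1 \<le> q" using p False unfolding q_def by (rule one_le_imp_one_le_enn2real)
    have wq: "(\<lambda>t. w t powr q) absolutely_integrable_on {0..2*pi}"
      using w False nonneg by (intro nonnegative_absolutely_integrable_1) (auto simp: in_Lp_circle_def q_def)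
    have "(1/(2*pi) * integral {0..2*pi} (\<lambda>t. cmod (\<phi> (of_real r * cis t)) powr q)) powr (1 / q)
        \<le> (1/(2*pi) * integral {0..2*pi} (\<lambda>t. w t powr q)) powr (1 / q)" if r: "0 < r" "r < 1" for r
    proof -
      have rz: "cmod (of_real r * cis t) < 1" for t using r by (simp add: norm_mult)
      have "continuous_on {0..2*pi} (\<lambda>t. \<phi> (of_real r * cis t))"
        by (rule continuous_on_compose2[OF holomorphic_on_imp_continuous_on[OF hol]])
          (use rz in \<open>auto intro!: continuous_intros\<close>)
      then have int: "(\<lambda>t. cmod (\<phi> (of_real r * cis t)) powr q) integrable_on {0..2*pi}"
        using q by (intro integrable_continuous_real continuous_on_powr' continuous_intros) auto
      have "cmod (\<phi> (of_real r * cis s)) powr q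
          \<le> integral {0..2*pi} (\<lambda>t. poisson_kernel (of_real r * cis s) t * w t powr q)" for s
      proof -
        have "cmod (\<phi> (of_real r * cis s)) powr q
            \<le> integral {0..2*pi} (\<lambda>t. poisson_kernel (of_real r * cis s) t * w t) powr q"
          using q by (intro powr_mono2 le rz) auto
        also have "\<dots> \<le> integral {0..2*pi} (\<lambda>t. poisson_kernel (of_real r * cis s) t * w t powr q)"
          by (rule poisson_jensen[OF rz q nonneg aw wq])
        finally show ?thesis .
      qed
      then have "integral {0..2*pi} (\<lambda>t. cmod (\<phi> (of_real r * cis t)) powr q) \<le> integral {0..2*pi} (\<lambda>t. w t powr q)"
        using r by (intro integral_poisson_le[where r = r] wq int) auto
      moreover have "0 \<le> integral {0..2*pi} (\<lambda>t. cmod (\<phi> (of_real r * cis t)) powr q)"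
        by (intro integral_nonneg int) auto
      ultimately show ?thesis using q by (intro powr_mono2 mult_left_mono) auto
    qed
    then show ?thesis using hol False unfolding hardy_def q_def by (simp only: if_False) blast
  qed
qed

section \<open>Derivatives of Poisson integrals\<close>

text \<open>For continuous \<open>G\<close> this is 2 pi times the derivative of the Cauchy integral
  of \<open>G\<close> over the unit circle, that is, the derivative of the integral of
  \<open>G t / (1 - z * cis (-t))\<close>.\<close>

definition cauchy_circle_deriv :: "(real \<Rightarrow> complex) \<Rightarrow> complex \<Rightarrow> complex" where
  "cauchy_circle_deriv G z = integral {0..2*pi} (\<lambda>t. G t * cis (-t) / (1 - z * cis (-t))\<^sup>2)"

lemma cauchy_circle_deriv_holomorphic:
  assumes "continuous_on {0..2*pi} G"
  shows "cauchy_circle_deriv G holomorphic_on ball 0 1"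
proof -
  have "continuous_on {0..2*pi} (\<lambda>t. G t * cis (-t))"
    by (intro continuous_intros assms)
  from cauchy_integral_circle_has_field_derivative[OF this, of _ 2]
  have "cauchy_circle_deriv G field_differentiable (at z)" if "cmod z < 1" for z
    using that unfolding cauchy_circle_deriv_def field_differentiable_def by blast
  then show ?thesis
    by (simp add: holomorphic_on_def field_differentiable_at_within)
qed

text \<open>The real derivative of a Poisson integral is a complex linear map plus a conjugate
  linear one; \<open>dz\<close> picks out the first and \<open>dzbar\<close> the second. The
  products with 1 and \<open>\<i>\<close> stay unsimplified to match the unfolded
  definitions.\<close>

lemma wirtinger_dz:
  "((1 * H + cnj (1 * C)) / d - \<i> * ((\<i> * H + cnj (\<i> * C)) / d)) / 2 = H / d" for H C d :: complex
  by (simp add: algebra_simps add_divide_distrib diff_divide_distrib flip: mult.assoc)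

lemma wirtinger_dzbar:
  "((1 * H + cnj (1 * C)) / d + \<i> * ((\<i> * H + cnj (\<i> * C)) / d)) / 2 = cnj C / d" for H C d :: complex
  by (simp add: algebra_simps add_divide_distrib diff_divide_distrib flip: mult.assoc)

context
  fixes F :: "complex \<Rightarrow> complex"
  assumes cont: "continuous_on {0..2*pi} (\<lambda>t. F (cis t))"
begin

text \<open>Integrating the partial fractions of the kernel against \<open>F\<close> writes the
  Poisson integral as a holomorphic function plus the conjugate of another one plus a
  constant.\<close>

lemma poisson_integral_eq_cauchy:
  assumes z: "cmod z < 1"
  shows "poisson_integral F z = (integral {0..2*pi} (\<lambda>t. F (cis t) / (1 - z * cis (-t)))
     + cnj (integral {0..2*pi} (\<lambda>t. cnj (F (cis t)) / (1 - z * cis (-t))))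
     - integral {0..2*pi} (\<lambda>t. F (cis t))) / (2 * pi)"
proof -
  note nz = one_minus_cis_nonzero[OF z]
  have int: "(\<lambda>t. A t / (1 - z * cis (-t))) integrable_on {0..2*pi}" if "continuous_on {0..2*pi} A" for A
    using nz by (intro integrable_continuous_real continuous_intros that) auto
  have "((\<lambda>t. (F (cis t) / (1 - z * cis (-t)) + cnj (cnj (F (cis t)) / (1 - z * cis (-t))) - F (cis t)) / (2 * pi))
    has_integral (integral {0..2*pi} (\<lambda>t. F (cis t) / (1 - z * cis (-t)))
     + cnj (integral {0..2*pi} (\<lambda>t. cnj (F (cis t)) / (1 - z * cis (-t))))
     - integral {0..2*pi} (\<lambda>t. F (cis t))) / (2 * pi)) {0..2*pi}"
    by (intro has_integral_divide has_integral_diff has_integral_add integrable_integral int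
        has_integral_linear[OF _ bounded_linear_cnj, unfolded o_def] integrable_continuous_real
        continuous_intros cont)
  moreover have "(F (cis t) / (1 - z * cis (-t)) + cnj (cnj (F (cis t)) / (1 - z * cis (-t))) - F (cis t)) / (2 * pi)
     = of_real (poisson_kernel z t) * F (cis t)" for t
    unfolding poisson_kernel_eq[OF z] by (simp add: cis_cnj field_simps)
  ultimately show ?thesis
    unfolding poisson_integral_def by (simp add: integral_unique)
qed

text \<open>Both Cauchy integrals are differentiated with exponent \<open>m = 1\<close>; conjugating
  the second gives the conjugate linear term.\<close>

lemma poisson_integral_has_derivative:
  assumes z: "cmod z < 1"
  shows "(poisson_integral F has_derivative
     (\<lambda>h. (h * cauchy_circle_deriv (\<lambda>t. F (cis t)) z
           + cnj (h * cauchy_circle_deriv (\<lambda>t. cnj (F (cis t))) z)) / (2 * pi))) (at z)"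
proof -
  have der: "((\<lambda>z. integral {0..2*pi} (\<lambda>t. A t / (1 - z * cis (-t)))) has_derivative (\<lambda>h. h * cauchy_circle_deriv A z)) (at z)"
    if "continuous_on {0..2*pi} A" for A
    using cauchy_integral_circle_has_field_derivative[OF that z, of 1]
    by (simp add: has_field_derivative_def cauchy_circle_deriv_def power2_eq_square mult.commute[of _ "integral _ _"])
  have "((\<lambda>z. (integral {0..2*pi} (\<lambda>t. F (cis t) / (1 - z * cis (-t)))
     + cnj (integral {0..2*pi} (\<lambda>t. cnj (F (cis t)) / (1 - z * cis (-t))))
     - integral {0..2*pi} (\<lambda>t. F (cis t))) / (2 * pi)) has_derivative
     (\<lambda>h. (h * cauchy_circle_deriv (\<lambda>t. F (cis t)) z
           + cnj (h * cauchy_circle_deriv (\<lambda>t. cnj (F (cis t))) z) - 0) / (2 * pi))) (at z)"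
    by (rule bounded_linear.has_derivative[OF bounded_linear_divide
          has_derivative_diff[OF has_derivative_add[OF der
            bounded_linear.has_derivative[OF bounded_linear_cnj der]] has_derivative_const]])
      (intro continuous_intros cont)+
  then show ?thesis
    \<comment> \<open>The decomposition is known inside the disk only, so the derivative is
      transferred on the open ball.\<close>
    by (rule_tac has_derivative_transform_within_open[where s = "ball 0 1"])
      (use z in \<open>auto simp: poisson_integral_eq_cauchy\<close>)
qed

lemma dz_poisson_integral:
  assumes "cmod z < 1"
  shows "dz (poisson_integral F) z = cauchy_circle_deriv (\<lambda>t. F (cis t)) z / (2 * pi)"
  unfolding dz_def frechet_derivative_at[OF poisson_integral_has_derivative[OF assms], symmetric]
  by (rule wirtinger_dz)

lemma dzbar_poisson_integral:
  assumes "cmod z < 1"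
  shows "dzbar (poisson_integral F) z = cnj (cauchy_circle_deriv (\<lambda>t. cnj (F (cis t))) z) / (2 * pi)"
  unfolding dzbar_def frechet_derivative_at[OF poisson_integral_has_derivative[OF assms], symmetric]
  by (rule wirtinger_dzbar)

lemma dz_poisson_integral_holomorphic: "dz (poisson_integral F) holomorphic_on ball 0 1"
proof -
  have "(\<lambda>z. cauchy_circle_deriv (\<lambda>t. F (cis t)) z / (2 * pi)) holomorphic_on ball 0 1"
    by (intro holomorphic_intros cauchy_circle_deriv_holomorphic cont) auto
  then show ?thesis
    by (rule holomorphic_transform) (simp add: dz_poisson_integral)
qed

lemma cnj_dzbar_poisson_integral_holomorphic:
  "(\<lambda>z. cnj (dzbar (poisson_integral F) z)) holomorphic_on ball 0 1"
proof -
  have "(\<lambda>z. cauchy_circle_deriv (\<lambda>t. cnj (F (cis t))) z / (2 * pi)) holomorphic_on ball 0 1"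
    by (intro holomorphic_intros cauchy_circle_deriv_holomorphic continuous_intros cont) auto
  then show ?thesis
    by (rule holomorphic_transform) (simp add: dzbar_poisson_integral)
qed

end

section \<open>The angular derivative of the Poisson integral\<close>

lemma abs_cont_on_interval_cnj:
  "abs_cont_on_interval G a b \<Longrightarrow> abs_cont_on_interval (\<lambda>t. cnj (G t)) a b"
  unfolding abs_cont_on_interval_def complex_cnj_diff[symmetric] complex_mod_cnj .

text \<open>The value of the integral below is the angular derivative of the Poisson integral at \<open>z\<close>.\<close>

lemma poisson_integral_deriv_has_integral:
  assumes ac: "abs_cont_circle F" and N: "negligible N"
    and der: "\<And>t. t \<in> {0..2*pi} - N \<Longrightarrow> ((\<lambda>s. F (cis s)) has_vector_derivative g t) (at t)"
    and z: "cmod z < 1"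
  shows "((\<lambda>t. poisson_kernel z t *\<^sub>R g t) has_integral
     \<i> * (z * dz (poisson_integral F) z - cnj z * dzbar (poisson_integral F) z)) {0..2*pi}"
proof -
  define G where "G = (\<lambda>t. F (cis t))"
  have acG: "abs_cont_on_interval G 0 (2*pi)" using ac by (simp add: abs_cont_circle_def G_def)
  note cont = abs_cont_on_interval_imp_continuous_on[OF acG, unfolded G_def]
  have per: "G 0 = G (2*pi)" by (simp add: G_def)
  have dG: "(G has_vector_derivative g t) (at t within {0..2*pi})" if "t \<in> {0..2*pi} - N" for t
    unfolding G_def using der[OF that] by (rule has_vector_derivative_at_within)
  have dcG: "((\<lambda>t. cnj (G t)) has_vector_derivative cnj (g t)) (at t within {0..2*pi})" if "t \<in> {0..2*pi} - N" for t
    using bounded_linear.has_vector_derivative[OF bounded_linear_cnj dG[OF that]] .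
  have I1: "((\<lambda>t. g t / (1 - z * cis (-t))) has_integral \<i> * z * cauchy_circle_deriv G z) {0..2*pi}"
    unfolding cauchy_circle_deriv_def by (rule has_integral_cauchy_circle_deriv[OF acG per N dG z])
  have "((\<lambda>t. cnj (g t) / (1 - z * cis (-t))) has_integral \<i> * z * cauchy_circle_deriv (\<lambda>t. cnj (G t)) z) {0..2*pi}"
    unfolding cauchy_circle_deriv_def
    by (rule has_integral_cauchy_circle_deriv[OF abs_cont_on_interval_cnj[OF acG] _ N dcG z]) (use per in auto)
  then have I2: "((\<lambda>t. cnj (cnj (g t) / (1 - z * cis (-t)))) has_integral
      cnj (\<i> * z * cauchy_circle_deriv (\<lambda>t. cnj (G t)) z)) {0..2*pi}"
    by (rule has_integral_linear[OF _ bounded_linear_cnj, unfolded o_def])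
  \<comment> \<open>The boundary function has equal values at 0 and 2 pi, so its derivative has
    integral zero; this disposes of the constant term -1 of the kernel.\<close>
  have I3: "(g has_integral 0) {0..2*pi}"
    using abs_cont_has_integral_deriv[OF _ acG N dG] per by simp
  have "((\<lambda>t. (g t / (1 - z * cis (-t)) + cnj (cnj (g t) / (1 - z * cis (-t))) - g t) / (2 * pi)) has_integral
     (\<i> * z * cauchy_circle_deriv G z + cnj (\<i> * z * cauchy_circle_deriv (\<lambda>t. cnj (G t)) z) - 0) / (2 * pi)) {0..2*pi}"
    by (intro has_integral_divide has_integral_diff has_integral_add I1 I2 I3)
  moreover have "(g t / (1 - z * cis (-t)) + cnj (cnj (g t) / (1 - z * cis (-t))) - g t) / (2 * pi)
     = poisson_kernel z t *\<^sub>R g t" for t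
    unfolding scaleR_conv_of_real poisson_kernel_eq[OF z] by (simp add: cis_cnj field_simps)
  \<comment> \<open>Conjugating the factor \<open>\<i>\<close> produces the minus sign in front of
    the \<open>dzbar\<close> term.\<close>
  moreover have "(\<i> * z * cauchy_circle_deriv G z + cnj (\<i> * z * cauchy_circle_deriv (\<lambda>t. cnj (G t)) z) - 0) / (2 * pi)
     = \<i> * (z * dz (poisson_integral F) z - cnj z * dzbar (poisson_integral F) z)"
    unfolding dz_poisson_integral[OF cont z] dzbar_poisson_integral[OF cont z] G_def
    by (simp add: field_simps)
  ultimately show ?thesis by simp
qed

section \<open>Ellipticity and the final estimate\<close>

text \<open>With a = |f_z| and b = |f_zbar|, ellipticity reads (a + b) ((a + b) - K (a - b)) \<le>
  K'. If the claim failed, both factors would exceed \<open>sqrt K'\<close>, and their product would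
  exceed K'.\<close>

lemma elliptic_mapping_Dnorm_le:
  assumes "elliptic_mapping K K' f" "1 \<le> K" "0 \<le> K'" "cmod z < 1"
  shows "Dnorm f z \<le> K * (cmod (dz f z) - cmod (dzbar f z)) + sqrt K'"
proof (rule ccontr)
  define a b where "a = cmod (dz f z)" and "b = cmod (dzbar f z)"
  have ab: "0 \<le> a" "0 \<le> b" by (auto simp: a_def b_def)
  have J: "a\<^sup>2 - b\<^sup>2 > 0" "(a + b)\<^sup>2 \<le> K * (a\<^sup>2 - b\<^sup>2) + K'"
    using assms by (auto simp: elliptic_mapping_def jacobian_def Dnorm_def a_def b_def)
  \<comment> \<open>Positivity of the Jacobian makes \<open>K * (a - b)\<close> nonnegative, so
    under the negated claim \<open>a + b\<close> itself also exceeds \<open>sqrt K'\<close>.\<close>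
  then have "b < a" using ab power_mono[of a b 2] by (meson diff_gt_0_iff_gt leD leI)
  assume "\<not> ?thesis"
  then have gt: "K * (a - b) + sqrt K' < a + b" by (simp add: Dnorm_def a_def b_def)
  have "sqrt K' < a + b" using gt assms(2) \<open>b < a\<close>
    by (smt (verit) mult_nonneg_nonneg)
  moreover have "sqrt K' < a + b - K * (a - b)" using gt by simp
  ultimately have "sqrt K' * sqrt K' < (a + b) * (a + b - K * (a - b))"
    using assms(3) by (intro mult_strict_mono) (auto intro: le_less_trans[OF real_sqrt_ge_zero])
  also have "\<dots> = (a + b)\<^sup>2 - K * (a\<^sup>2 - b\<^sup>2)"
    by (simp add: power2_eq_square algebra_simps)
  finally show False using J assms(3) by simp
qed

theorem theorem2:
  fixes p :: ennreal and K K' :: real and F :: "complex \<Rightarrow> complex"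
  assumes "1 \<le> p" and "K \<ge> 1" and "K' \<ge> 0"
    and "abs_cont_circle F"
    and "deriv_in_Lp_circle p F"
    and "elliptic_mapping K K' (poisson_integral F)"
  shows "hardy p (dz (poisson_integral F)) \<and>
         hardy p (\<lambda>z. cnj (dzbar (poisson_integral F) z))"
proof -
  let ?f = "poisson_integral F"
  have cont: "continuous_on {0..2*pi} (\<lambda>t. F (cis t))"
    using assms(4) unfolding abs_cont_circle_def by (rule abs_cont_on_interval_imp_continuous_on)
  obtain g where g: "in_Lp_circle p g"
    and "AE t in lebesgue. t \<in> {0..2*pi} \<longrightarrow> ((\<lambda>s. F (cis s)) has_vector_derivative g t) (at t)"
    using assms(5) unfolding deriv_in_Lp_circle_def by blast
  then obtain N where N: "negligible N"
    and der: "\<And>t. t \<in> {0..2*pi} - N \<Longrightarrow> ((\<lambda>s. F (cis s)) has_vector_derivative g t) (at t)"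
    by (auto simp: negligible_iff_null_sets elim!: AE_E3)
  have ag: "(\<lambda>t. norm (g t)) absolutely_integrable_on {0..2*pi}"
    using in_Lp_circle_absolutely_integrable[OF assms(1) g] by (rule absolutely_integrable_norm[unfolded o_def])
  define A where "A = (\<lambda>z. integral {0..2*pi} (\<lambda>t. poisson_kernel z t * norm (g t)))"
  have intA: "((\<lambda>t. poisson_kernel z t * norm (g t)) has_integral A z) {0..2*pi}" if "cmod z < 1" for z
    using poisson_kernel_mult_absolutely_integrable[OF that ag]
    unfolding A_def by (auto dest: set_lebesgue_integral_eq_integral(1))
  have Anonneg: "0 \<le> A z" if "cmod z < 1" for z
    using intA[OF that] by (rule has_integral_nonneg) (intro mult_nonneg_nonneg poisson_kernel_nonneg that norm_ge_zero)
  \<comment> \<open>The angular derivative is the Poisson integral of \<open>g\<close>; the reverse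
    triangle inequality and the positivity of the kernel give the bound by
    \<open>A z\<close>.\<close>
  have angular: "cmod z * (cmod (dz ?f z) - cmod (dzbar ?f z)) \<le> A z" if z: "cmod z < 1" for z
  proof -
    have I: "((\<lambda>t. poisson_kernel z t *\<^sub>R g t) has_integral
        \<i> * (z * dz ?f z - cnj z * dzbar ?f z)) {0..2*pi}"
      by (rule poisson_integral_deriv_has_integral[OF assms(4) N _ z]) (rule der)
    have "cmod z * (cmod (dz ?f z) - cmod (dzbar ?f z)) = cmod (z * dz ?f z) - cmod (cnj z * dzbar ?f z)"
      by (simp add: norm_mult algebra_simps)
    also have "\<dots> \<le> cmod (\<i> * (z * dz ?f z - cnj z * dzbar ?f z))"
      using norm_triangle_ineq2[of "z * dz ?f z" "cnj z * dzbar ?f z"] by (simp add: norm_mult)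
    also have "\<dots> \<le> A z"
      unfolding integral_unique[OF I, symmetric] A_def
      by (rule integral_norm_bound_integral[OF has_integral_integrable[OF I] has_integral_integrable[OF intA[OF z]]])
        (simp add: poisson_kernel_nonneg z)
    finally show ?thesis .
  qed
  \<comment> \<open>The angular estimate degenerates at the origin because of its factor
    \<open>cmod z\<close>, so near 0 \<open>Dnorm\<close> is bounded by continuity on a compact
    disk.\<close>
  have "continuous_on (ball 0 1) (dz ?f)" "continuous_on (ball 0 1) (dzbar ?f)"
    using assms(6) by (simp_all only: elliptic_mapping_def)
  then have "continuous_on (ball 0 1) (Dnorm ?f)"
    unfolding Dnorm_def by (intro continuous_intros)
  then have "continuous_on (cball 0 (1/2)) (Dnorm ?f)"
    by (rule continuous_on_subset) auto
  then have "bounded (Dnorm ?f ` cball 0 (1/2))"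
    by (intro compact_imp_bounded compact_continuous_image) auto
  then obtain B where B: "0 < B" "\<And>z. z \<in> cball 0 (1/2) \<Longrightarrow> \<bar>Dnorm ?f z\<bar> \<le> B"
    by (auto simp: bounded_pos)
  \<comment> \<open>The factor 2 bounds 1 / |z| outside the disk of radius 1/2, \<open>B\<close>
    covers that disk, and \<open>sqrt K'\<close> comes from ellipticity.\<close>
  define w where "w = (\<lambda>t. 2 * K * norm (g t) + (B + sqrt K'))"
  have w: "in_Lp_circle p (\<lambda>t. complex_of_real (w t))"
    unfolding w_def using assms(2,3) B(1) by (intro in_Lp_circle_affine_norm assms(1) g) auto
  have wnonneg: "0 \<le> w t" for t using assms(2,3) B(1) by (simp add: w_def)
  have le: "Dnorm ?f z \<le> integral {0..2*pi} (\<lambda>t. poisson_kernel z t * w t)" if z: "cmod z < 1" for z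
  proof -
    have "((\<lambda>t. 2 * K * (poisson_kernel z t * norm (g t)) + (B + sqrt K') * poisson_kernel z t) has_integral
        2 * K * A z + (B + sqrt K') * 1) {0..2*pi}"
      by (intro has_integral_add has_integral_mult_right intA poisson_kernel_has_integral_one z)
    then have "integral {0..2*pi} (\<lambda>t. poisson_kernel z t * w t) = 2 * K * A z + (B + sqrt K')"
      by (simp add: w_def algebra_simps integral_unique)
    moreover have "Dnorm ?f z \<le> 2 * K * A z + (B + sqrt K')"
    proof (cases "cmod z \<le> 1/2")
      case True
      then have "Dnorm ?f z \<le> B" using B(2)[of z] by simp
      moreover have "0 \<le> 2 * K * A z" using Anonneg[OF z] assms(2) by simp
      ultimately show ?thesis using assms(3) by (smt (verit) real_sqrt_ge_zero)
    next
      case False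
      let ?l = "cmod (dz ?f z) - cmod (dzbar ?f z)"
      have "?l \<le> 2 * A z"
      \<comment> \<open>Lowering the factor \<open>cmod z\<close> to 1/2 requires \<open>?l\<close>
        to be nonnegative; in the other case \<open>A z \<ge> 0\<close> suffices.\<close>
      proof (cases "?l \<le> 0")
        case True
        then show ?thesis using Anonneg[OF z] by linarith
      next
        case l: False
        then have "1/2 * ?l \<le> cmod z * ?l" using False by (intro mult_right_mono) auto
        also note angular[OF z]
        finally show ?thesis by simp
      qed
      then have "K * ?l \<le> K * (2 * A z)" using assms(2) by (intro mult_left_mono) auto
      also have "\<dots> = 2 * K * A z" by simp
      finally show ?thesis
        using elliptic_mapping_Dnorm_le[OF assms(6,2,3) z] B(1) by linarith
    qed
    ultimately show ?thesis by simp
  qed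
  \<comment> \<open>Each of the two moduli is at most \<open>Dnorm\<close>, so both derivatives are
    dominated by the Poisson integral of \<open>w\<close>.\<close>
  show ?thesis
  proof
    show "hardy p (dz ?f)"
      by (rule hardy_if_poisson_majorant[OF assms(1) dz_poisson_integral_holomorphic[OF cont] w wnonneg])
        (rule order_trans[OF _ le], auto simp: Dnorm_def)
    show "hardy p (\<lambda>z. cnj (dzbar ?f z))"
      by (rule hardy_if_poisson_majorant[OF assms(1) cnj_dzbar_poisson_integral_holomorphic[OF cont] w wnonneg])
        (rule order_trans[OF _ le], auto simp: Dnorm_def)
  qed
qed

end
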